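(* Let $H$ be an $\mathbb O$-Hilbert space. Let $H^{*_{\mathbb O}}$ be the set of all bounded $\mathbb O$-linear functionals $f:H\to\mathbb O$ (real linear maps with $f(px)=pf(x)$ for all $p\in\mathbb O$, $x\in H$), with norm $\|f\|=\sup_{\|x\|\le1}|f(x)|$, and let $$\mathscr A(H)=\{m\in H: (pq)m=p(qm)\text{ for all }p,q\in\mathbb O\}$$ be the nucleus of $H$, with the norm of $H$. Then there is an isometric isomorphism of real Banach spaces $$H^{*_{\mathbb O}}\cong\mathscr A(H).$$
   Context: $\mathbb O$ denotes the octonions, with conjugation $\overline{\,\cdot\,}$, norm $|\cdot|$ and real part $\mathrm{Re}$. A left $\mathbb O$-module is a real vector space $M$ with an $\mathbb R$-bilinear scalar multiplication $\mathbb O\times M\to M$, $1m=m$, such that $r(rm)=r^2m$ for all $r\in\mathbb O$, $m\in M$ (equivalently, $[p,q,m]:=(pq)m-p(qm)$ satisfies $[p,q,m]=-[q,p,m]$). A real linear map $f:M\to\mathbb O$ is $\mathbb O$-para-linear if $\mathrm{Re}\,(f(px)-pf(x))=0$ for all $p\in\mathbb O$, $x\in M$. A pre-Hilbert left $\mathbb O$-module is a left $\mathbb O$-module $H$ with an $\mathbb R$-bilinear map $\langle\cdot,\cdot\rangle:H\times H\to\mathbb O$ such that: (1) $\langle\cdot,u\rangle$ is $\mathbb O$-para-linear for all $u\in H$; (2) $\langle u,v\rangle=\overline{\langle v,u\rangle}$; (3) $\langle u,u\rangle$ is a nonnegative real number, equal to $0$ iff $u=0$. An $\mathbb O$-Hilbert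 space is a pre-Hilbert left $\mathbb O$-module complete with respect to $\|u\|=\sqrt{\langle u,u\rangle}$. *)

theory Defs
  imports "HOL-Analysis.Analysis"
begin

text \<open>The octonions are obtained from the complex numbers by two Cayley-Dickson doublings
  \<open>(a, b) (c, d) = (a c - d\<^sup>* b, d a + b c\<^sup>*)\<close>, \<open>(a, b)\<^sup>* = (a\<^sup>*, -b)\<close>.
  The first one gives the quaternions, as pairs of complex numbers.\<close>

type_synonym quat = "complex \<times> complex"

definition qmult :: "quat \<Rightarrow> quat \<Rightarrow> quat" where
  "qmult x y = (fst x * fst y - cnj (snd y) * snd x, snd y * fst x + snd x * cnj (fst y))"

definition qcnj :: "quat \<Rightarrow> quat" where
  "qcnj x = (cnj (fst x), - snd x)"

datatype octo = Octo (octo_fst: quat) (octo_snd: quat)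

instantiation octo :: real_vector
begin

definition "0 = Octo 0 0"
definition "x + y = Octo (octo_fst x + octo_fst y) (octo_snd x + octo_snd y)"
definition "x - y = Octo (octo_fst x - octo_fst y) (octo_snd x - octo_snd y)"
definition "- x = Octo (- octo_fst x) (- octo_snd x)"
definition "r *\<^sub>R x = Octo (r *\<^sub>R octo_fst x) (r *\<^sub>R octo_snd x)"

instance
proof
  fix x y z :: octo and r s :: real
  show "x + y + z = x + (y + z)" "x + y = y + x" "0 + x = x" "- x + x = 0" "x - y = x + - y"
    "r *\<^sub>R (x + y) = r *\<^sub>R x + r *\<^sub>R y" "(r + s) *\<^sub>R x = r *\<^sub>R x + s *\<^sub>R x"
    "r *\<^sub>R s *\<^sub>R x = (r * s) *\<^sub>R x" "1 *\<^sub>R x = x"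
    by (simp_all add: plus_octo_def zero_octo_def uminus_octo_def minus_octo_def
        scaleR_octo_def algebra_simps)
qed

end

instantiation octo :: real_inner
begin

definition "inner x y = inner (octo_fst x) (octo_fst y) + inner (octo_snd x) (octo_snd y)"
definition "norm (x :: octo) = sqrt (inner x x)"
definition "sgn (x :: octo) = x /\<^sub>R norm x"
definition "dist (x :: octo) y = norm (x - y)"
definition [code del]:
  "(uniformity :: (octo \<times> octo) filter) = (INF e\<in>{0<..}. principal {(x, y). dist x y < e})"
definition [code del]:
  "open (U :: octo set) \<longleftrightarrow>
     (\<forall>x\<in>U. eventually (\<lambda>(x', y). x' = x \<longrightarrow> y \<in> U) uniformity)"

instance
proof
  fix x y z :: octo and r :: real and U :: "octo set"
  show "inner x y = inner y x" "inner (x + y) z = inner x z + inner y z"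
    "inner (r *\<^sub>R x) y = r * inner x y" "0 \<le> inner x x"
    by (simp_all add: plus_octo_def scaleR_octo_def inner_octo_def inner_commute algebra_simps)
  show "inner x x = 0 \<longleftrightarrow> x = 0"
    by (cases x) (auto simp: inner_octo_def zero_octo_def add_nonneg_eq_0_iff)
qed (simp_all add: norm_octo_def sgn_octo_def dist_octo_def uniformity_octo_def open_octo_def)

end

instantiation octo :: euclidean_space
begin

definition "Basis = (\<lambda>b. Octo (fst b) (snd b)) ` (Basis :: (quat \<times> quat) set)"

instance
proof
  have pair: "inner (Octo (fst b) (snd b)) x = inner b (octo_fst x, octo_snd x)" for b x
    by (simp add: inner_octo_def inner_prod_def)
  show "finite (Basis :: octo set)" "(Basis :: octo set) \<noteq> {}"
    by (simp_all add: Basis_octo_def)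
  show "inner u v = (if u = v then 1 else 0)" if "u \<in> Basis" "v \<in> Basis" for u v :: octo
  proof -
    obtain a b where "a \<in> Basis" "b \<in> Basis" "u = Octo (fst a) (snd a)" "v = Octo (fst b) (snd b)"
      using \<open>u \<in> Basis\<close> \<open>v \<in> Basis\<close> by (auto simp: Basis_octo_def)
    then show ?thesis
      using inner_Basis[of a b] by (auto simp: pair prod_eq_iff)
  qed
  show "(\<forall>u\<in>Basis. inner x u = 0) \<longleftrightarrow> x = 0" for x :: octo
  proof -
    have "(\<forall>u\<in>Basis. inner x u = 0) \<longleftrightarrow> (\<forall>b\<in>Basis. inner (octo_fst x, octo_snd x) b = 0)"
      unfolding Basis_octo_def by (auto simp: pair inner_commute[of x] inner_commute[of "(_, _)"])
    also have "\<dots> \<longleftrightarrow> x = 0"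
      by (subst euclidean_all_zero_iff) (cases x, simp add: zero_octo_def zero_prod_def)
    finally show ?thesis .
  qed
qed

end

instantiation octo :: "{one, times}"
begin

definition "1 = Octo (1, 0) 0"
definition "x * y =
  Octo (qmult (octo_fst x) (octo_fst y) - qmult (qcnj (octo_snd y)) (octo_snd x))
       (qmult (octo_snd y) (octo_fst x) + qmult (octo_snd x) (qcnj (octo_fst y)))"

instance ..

end

definition octo_cnj :: "octo \<Rightarrow> octo" where
  "octo_cnj x = Octo (qcnj (octo_fst x)) (- octo_snd x)"

definition octo_Re :: "octo \<Rightarrow> real" where
  "octo_Re x = Re (fst (octo_fst x))"

lemmas octo_simps = plus_octo_def zero_octo_def uminus_octo_def minus_octo_def scaleR_octo_def
  one_octo_def times_octo_def octo_cnj_def octo_Re_def qmult_def qcnj_def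

lemma octo_eq_iff:
  "x = y \<longleftrightarrow> octo_fst x = octo_fst y \<and> octo_snd x = octo_snd y"
  by (cases x; cases y) simp

lemma octo_mult_one: "1 * x = x" "x * 1 = (x :: octo)"
  by (simp_all add: octo_simps octo_eq_iff prod_eq_iff complex_eq_iff)

lemma bilinear_octo_mult: "bilinear ((*) :: octo \<Rightarrow> octo \<Rightarrow> octo)"
  unfolding bilinear_def
  by (auto intro!: linearI simp: octo_simps octo_eq_iff prod_eq_iff complex_eq_iff algebra_simps)

lemma octo_alternative: "x * (x * y) = (x * x) * y" "(y * x) * x = y * (x * (x :: octo))"
  by (simp_all add: octo_simps octo_eq_iff prod_eq_iff complex_eq_iff algebra_simps)

lemma octo_mult_cnj: "x * octo_cnj x = (norm x)\<^sup>2 *\<^sub>R 1"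
  by (simp add: norm_octo_def inner_octo_def octo_simps octo_eq_iff prod_eq_iff complex_eq_iff
      inner_prod_def inner_complex_def algebra_simps)

lemma octo_norm_mult: "norm (x * y) = norm x * norm (y :: octo)"
proof -
  have "inner (x * y) (x * y) = inner x x * inner y y"
    by (simp add: inner_octo_def octo_simps inner_prod_def inner_complex_def algebra_simps)
  then show ?thesis
    by (simp add: norm_octo_def real_sqrt_mult)
qed

class octo_module = real_vector +
  fixes osmult :: "octo \<Rightarrow> 'a \<Rightarrow> 'a"  (infixr "*\<^sub>O" 75)
  assumes osmult_add_left: "(p + q) *\<^sub>O x = p *\<^sub>O x + q *\<^sub>O x"
    and osmult_scaleR_left: "(r *\<^sub>R p) *\<^sub>O x = r *\<^sub>R (p *\<^sub>O x)"
    and osmult_add_right: "p *\<^sub>O (x + y) = p *\<^sub>O x + p *\<^sub>O y"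
    and osmult_scaleR_right: "p *\<^sub>O (r *\<^sub>R x) = r *\<^sub>R (p *\<^sub>O x)"
    and osmult_one: "1 *\<^sub>O x = x"
    and osmult_alternative: "p *\<^sub>O (p *\<^sub>O x) = (p * p) *\<^sub>O x"
begin

definition para_linear :: "('a \<Rightarrow> octo) \<Rightarrow> bool" where
  "para_linear f \<longleftrightarrow>
     (\<forall>x y. f (x + y) = f x + f y) \<and> (\<forall>r x. f (r *\<^sub>R x) = r *\<^sub>R f x) \<and>
     (\<forall>p x. octo_Re (f (p *\<^sub>O x) - p * f x) = 0)"

end

definition octo_linear :: "('a::octo_module \<Rightarrow> octo) \<Rightarrow> bool" where
  "octo_linear f \<longleftrightarrow> linear f \<and> (\<forall>p x. f (p *\<^sub>O x) = p * f x)"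

text \<open>The octonions are not an instance of \<open>real_algebra_1\<close>, so the real number \<open>r\<close> is
  embedded as \<open>r *\<^sub>R 1\<close> instead of \<open>of_real r\<close>.\<close>

class octo_pre_hilbert = octo_module +
  fixes oinner :: "'a \<Rightarrow> 'a \<Rightarrow> octo"
  assumes oinner_add_left: "oinner (u + v) w = oinner u w + oinner v w"
    and oinner_scaleR_left: "oinner (r *\<^sub>R u) w = r *\<^sub>R oinner u w"
    and oinner_add_right: "oinner w (u + v) = oinner w u + oinner w v"
    and oinner_scaleR_right: "oinner w (r *\<^sub>R u) = r *\<^sub>R oinner w u"
    and para_linear_oinner: "para_linear (\<lambda>x. oinner x u)"
    and oinner_cnj: "oinner u v = octo_cnj (oinner v u)"
    and oinner_self_nonneg: "\<exists>r\<ge>0. oinner u u = r *\<^sub>R 1"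
    and oinner_self_eq_0_iff: "oinner u u = 0 \<longleftrightarrow> u = 0"
begin

definition oinner_norm :: "'a \<Rightarrow> real" where
  "oinner_norm u = sqrt (octo_Re (oinner u u))"

lemma Re_oinner_Cauchy_Schwarz: "octo_Re (oinner x y) \<le> oinner_norm x * oinner_norm y"
  and oinner_norm_triangle: "oinner_norm (x + y) \<le> oinner_norm x + oinner_norm y"
  and oinner_norm_eq_0: "oinner_norm x = 0 \<longleftrightarrow> x = 0"
  and oinner_norm_scaleR: "oinner_norm (a *\<^sub>R x) = \<bar>a\<bar> * oinner_norm x"
proof -
  define B where "B x y = octo_Re (oinner x y)" for x y
  have add: "B (x + y) z = B x z + B y z" and scale: "B (r *\<^sub>R x) z = r * B x z" for x y z r
    by (simp_all add: B_def oinner_add_left oinner_scaleR_left plus_octo_def scaleR_octo_def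
        octo_Re_def)
  have comm: "B x y = B y x" for x y
    unfolding B_def by (subst oinner_cnj) (simp add: octo_cnj_def qcnj_def octo_Re_def)
  have add': "B z (x + y) = B z x + B z y" and scale': "B z (r *\<^sub>R x) = r * B z x" for x y z r
    by (simp_all add: comm[of z] add scale)
  have nonneg: "0 \<le> B x x" for x
    using oinner_self_nonneg[of x] by (auto simp: B_def octo_Re_def scaleR_octo_def one_octo_def)
  have zero: "B x x = 0 \<longleftrightarrow> x = 0" for x
    using oinner_self_nonneg[of x] oinner_self_eq_0_iff[of x]
    by (auto simp: B_def octo_Re_def scaleR_octo_def one_octo_def zero_octo_def zero_prod_def)
  have n: "oinner_norm x = sqrt (B x x)" for x
    by (simp add: oinner_norm_def B_def)
  have CS: "B x y \<le> oinner_norm x * oinner_norm y" for x y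
  proof (cases "y = 0")
    case True
    then have "B x y = 0" using add[of 0 0 x] comm[of x y] by simp
    then show ?thesis using nonneg by (simp add: n)
  next
    case False
    then have pos: "B y y > 0" using zero[of y] nonneg[of y] by simp
    define t where "t = - B x y / B y y"
    have "B (x + t *\<^sub>R y) (x + t *\<^sub>R y) = B x x + 2 * t * B x y + t * t * B y y"
      by (simp add: add scale add' scale' comm[of y x] algebra_simps)
    also have "\<dots> = B x x - (B x y)\<^sup>2 / B y y"
      using pos by (simp add: t_def power2_eq_square field_simps)
    finally have "(B x y)\<^sup>2 / B y y \<le> B x x"
      using nonneg[of "x + t *\<^sub>R y"] by simp
    then have "(B x y)\<^sup>2 \<le> B x x * B y y"
      using pos by (simp add: divide_le_eq)
    then show ?thesis
      by (simp add: n real_le_rsqrt flip: real_sqrt_mult)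
  qed
  then show "octo_Re (oinner x y) \<le> oinner_norm x * oinner_norm y"
    by (simp add: B_def)
  have "B (x + y) (x + y) = B x x + 2 * B x y + B y y"
    by (simp add: add add' comm[of y x])
  also have "\<dots> \<le> (oinner_norm x + oinner_norm y)\<^sup>2"
    using CS[of x y] nonneg[of x] nonneg[of y] by (simp add: power2_sum) (simp add: n)
  finally show "oinner_norm (x + y) \<le> oinner_norm x + oinner_norm y"
    unfolding n[of "x + y"] by (rule real_le_lsqrt[rotated]) (simp add: n nonneg)
  show "oinner_norm x = 0 \<longleftrightarrow> x = 0"
    using zero by (simp add: n)
  show "oinner_norm (a *\<^sub>R x) = \<bar>a\<bar> * oinner_norm x"
    by (simp add: n scale scale' real_sqrt_mult mult.assoc[symmetric])
qed

end

text \<open>By the preceding lemma, requiring the library's norm axioms on top of the equation for the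
  norm is no restriction: the class consists of the pre-Hilbert modules that are complete
  for the norm induced by the inner product.\<close>

class octo_hilbert = octo_pre_hilbert + banach +
  assumes norm_eq_oinner_norm: "norm u = oinner_norm u"

definition nucleus :: "'a::octo_module set" where
  "nucleus = {m. \<forall>p q. (p * q) *\<^sub>O m = p *\<^sub>O (q *\<^sub>O m)}"

text \<open>The dual carries the operator norm of the type of bounded linear maps, which is the supremum
  over the closed unit ball, see \<open>norm_blinfun_eq_SUP\<close>.\<close>

definition octo_dual :: "('a::octo_hilbert \<Rightarrow>\<^sub>L octo) set" where
  "octo_dual = {f. octo_linear (blinfun_apply f)}"

lemma norm_blinfun_eq_SUP:
  fixes f :: "'a::real_normed_vector \<Rightarrow>\<^sub>L 'b::real_normed_vector"
  shows "norm f = (SUP x\<in>{x. norm x \<le> 1}. norm (blinfun_apply f x))"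
proof (rule antisym)
  have le: "norm (f x) \<le> norm f" if "norm x \<le> 1" for x
    using norm_blinfun[of f x] mult_left_mono[OF that, of "norm f"] by simp
  then have bdd: "bdd_above ((\<lambda>x. norm (f x)) ` {x. norm x \<le> 1})"
    by (auto intro!: bdd_aboveI)
  show "(SUP x\<in>{x. norm x \<le> 1}. norm (f x)) \<le> norm f"
    by (rule cSUP_least) (auto intro: le exI[of _ 0])
  have nonneg: "0 \<le> (SUP x\<in>{x. norm x \<le> 1}. norm (f x))"
    by (rule cSUP_upper2[OF bdd, of 0]) auto
  show "norm f \<le> (SUP x\<in>{x. norm x \<le> 1}. norm (f x))"
  proof (rule norm_blinfun_bound[OF nonneg])
    fix x
    show "norm (f x) \<le> (SUP x\<in>{x. norm x \<le> 1}. norm (f x)) * norm x"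
    proof (cases "x = 0")
      case False
      have "norm (f (x /\<^sub>R norm x)) \<le> (SUP x\<in>{x. norm x \<le> 1}. norm (f x))"
        by (rule cSUP_upper[OF _ bdd]) (use False in auto)
      then show ?thesis
        using False by (simp add: blinfun.scaleR_right field_simps)
    qed (simp add: blinfun.zero_right)
  qed
qed

definition banach_subspace :: "'a::real_normed_vector set \<Rightarrow> bool" where
  "banach_subspace S \<longleftrightarrow> subspace S \<and> complete S"

definition isometric_isomorphism_on ::
    "'a::real_normed_vector set \<Rightarrow> 'b::real_normed_vector set \<Rightarrow> ('a \<Rightarrow> 'b) \<Rightarrow> bool" where
  "isometric_isomorphism_on S T \<phi> \<longleftrightarrow>
     bij_betw \<phi> S T \<and>
     (\<forall>x\<in>S. \<forall>y\<in>S. \<phi> (x + y) = \<phi> x + \<phi> y) \<and>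
     (\<forall>r. \<forall>x\<in>S. \<phi> (r *\<^sub>R x) = r *\<^sub>R \<phi> x) \<and>
     (\<forall>x\<in>S. norm (\<phi> x) = norm x)"

end

theory Submission
  imports Defs
begin

text \<open>The scalar \<open>p\<close> acts with adjoint \<open>octo_cnj p\<close> for the real inner product
  \<open>octo_Re (oinner x y)\<close>, and a para-linear functional is determined by its real part. So Riesz
  representation of the real part of an octonion linear functional \<open>f\<close> yields \<open>m\<close> with
  \<open>f x = oinner x m\<close>. Taking adjoints, \<open>oinner (p *\<^sub>O x) m = p * oinner x m\<close> for all \<open>p\<close> and \<open>x\<close>
  says exactly that \<open>m\<close> lies in the nucleus.\<close>

section \<open>Riesz representation for a real Hilbert space\<close>

text \<open>The functional \<open>J\<close> attains its minimum by completeness, and the vanishing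
  of its first variation at a minimizer is the claim. An explicit form \<open>B\<close> keeps the
  result applicable to \<open>octo_Re (oinner x y)\<close>.\<close>

lemma riesz_representation:
  fixes B :: "'a::banach \<Rightarrow> 'a \<Rightarrow> real"
  assumes "bilinear B" and sym: "\<And>x y. B x y = B y x" and norm: "\<And>x. B x x = (norm x)\<^sup>2"
    and "bounded_linear g"
  shows "\<exists>m. \<forall>x. g x = B x m"
proof -
  interpret g: bounded_linear g by fact
  note B = bilinear_ladd[OF \<open>bilinear B\<close>] bilinear_radd[OF \<open>bilinear B\<close>]
    bilinear_lsub[OF \<open>bilinear B\<close>] bilinear_rsub[OF \<open>bilinear B\<close>]
    bilinear_lmul[OF \<open>bilinear B\<close>] bilinear_rmul[OF \<open>bilinear B\<close>]
  define J where "J x = (norm x)\<^sup>2 - 2 * g x" for x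
  obtain K where K: "\<And>x. norm (g x) \<le> norm x * K"
    using g.bounded by blast
  \<comment> \<open>Completing the square in \<open>norm x\<close> bounds \<open>J\<close>
    below.\<close>
  have lower: "- K\<^sup>2 \<le> J x" for x
  proof -
    have "g x \<le> norm x * K"
      using K[of x] by simp
    moreover have "0 \<le> (norm x - K)\<^sup>2" by simp
    ultimately show ?thesis
      unfolding J_def power2_diff by linarith
  qed
  define d where "d = Inf (range J)"
  have bdd: "bdd_below (range J)"
    using lower by (intro bdd_belowI2)
  have d_le: "d \<le> J x" for x
    unfolding d_def by (rule cInf_lower[OF _ bdd]) simp
  have "\<exists>x. J x < d + inverse (real (Suc n))" for n
    using cInf_lessD[of "range J" "d + inverse (real (Suc n))"] by (auto simp: d_def)
  then obtain X where X: "\<And>n. J (X n) < d + inverse (real (Suc n))"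
    by metis
  \<comment> \<open>Parallelogram law: the contributions of \<open>g\<close> cancel at the midpoint,
    where \<open>J\<close> is still at least \<open>d\<close>. Hence minimizing sequences are
    Cauchy.\<close>
  have near_minimal: "(norm (x - y))\<^sup>2 \<le> 2 * (J x - d) + 2 * (J y - d)" for x y
  proof -
    have "(norm (x - y))\<^sup>2 = 2 * J x + 2 * J y - 4 * J ((1/2) *\<^sub>R (x + y))"
      unfolding J_def norm[symmetric]
      by (simp add: B g.add g.scaleR sym[of y x] algebra_simps)
    then show ?thesis
      using mult_left_mono[OF d_le[of "(1/2) *\<^sub>R (x + y)"], of 4] by argo
  qed
  have "Cauchy X"
  proof (rule metric_CauchyI)
    fix e :: real assume "0 < e"
    obtain N where N: "inverse (real (Suc N)) < e\<^sup>2 / 4"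
      using reals_Archimedean[of "e\<^sup>2 / 4"] \<open>0 < e\<close> by auto
    show "\<exists>M. \<forall>m\<ge>M. \<forall>n\<ge>M. dist (X m) (X n) < e"
    proof (intro exI allI impI)
      fix m n assume "N \<le> m" "N \<le> n"
      have "inverse (real (Suc k)) \<le> inverse (real (Suc N))" if "N \<le> k" for k
        using that by simp
      then have "J (X m) < d + e\<^sup>2 / 4" "J (X n) < d + e\<^sup>2 / 4"
        using X[of m] X[of n] N \<open>N \<le> m\<close> \<open>N \<le> n\<close> by (smt (verit))+
      then have "(norm (X m - X n))\<^sup>2 < e\<^sup>2"
        using near_minimal[of "X m" "X n"] by argo
      then show "dist (X m) (X n) < e"
        using \<open>0 < e\<close> by (simp add: dist_norm power2_less_imp_less)
    qed
  qed
  then obtain m where m: "X \<longlonglongrightarrow> m"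
    using Cauchy_convergent convergent_def by blast
  have "(\<lambda>n. J (X n)) \<longlonglongrightarrow> J m"
    unfolding J_def by (intro tendsto_intros g.tendsto m)
  moreover have "(\<lambda>n. d + inverse (real (Suc n))) \<longlonglongrightarrow> d"
    using tendsto_add[OF tendsto_const LIMSEQ_inverse_real_of_nat] by simp
  ultimately have "J m \<le> d"
    using X by (intro LIMSEQ_le) (auto intro: less_imp_le)
  have "g x = B x m" for x
  proof -
    define c where "c = B x m - g x"
    have quadratic: "J (m + t *\<^sub>R x) = J m + 2 * t * c + t\<^sup>2 * (norm x)\<^sup>2" for t
      unfolding J_def norm[symmetric] c_def
      by (simp add: B g.add g.scaleR sym[of m x] algebra_simps power2_eq_square)
    have ineq: "0 \<le> 2 * t * c + t\<^sup>2 * (norm x)\<^sup>2" for t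
      using d_le[of "m + t *\<^sub>R x"] \<open>J m \<le> d\<close> unfolding quadratic by linarith
    have "c = 0"
    proof (rule ccontr)
      assume "c \<noteq> 0"
      \<comment> \<open>The displacement \<open>t = - s * c\<close> is short enough for the linear
        term to outweigh the quadratic one; the summand 1 covers \<open>x = 0\<close>.\<close>
      define s where "s = 1 / (1 + (norm x)\<^sup>2)"
      have s: "0 < s" "s * (norm x)\<^sup>2 < 1"
        by (auto simp: s_def add_pos_nonneg)
      have "0 \<le> s * c\<^sup>2 * (s * (norm x)\<^sup>2 - 2)"
        using ineq[of "- s * c"] by (simp add: algebra_simps power2_eq_square)
      moreover have "s * c\<^sup>2 * (s * (norm x)\<^sup>2 - 2) < 0"
        using s \<open>c \<noteq> 0\<close> by (intro mult_pos_neg) auto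
      ultimately show False by linarith
    qed
    then show ?thesis by (simp add: c_def)
  qed
  then show ?thesis by blast
qed

section \<open>Real part, conjugation and norm of octonions\<close>

lemma octo_Re_linear: "linear octo_Re"
  by (auto intro!: linearI simp: octo_simps)

lemmas octo_Re_simps =
  linear_add[OF octo_Re_linear] linear_diff[OF octo_Re_linear] linear_scale[OF octo_Re_linear]

lemma octo_Re_one [simp]: "octo_Re 1 = 1"
  by (simp add: octo_simps)

lemma octo_Re_cnj [simp]: "octo_Re (octo_cnj x) = octo_Re x"
  by (simp add: octo_simps)

lemma octo_cnj_cnj [simp]: "octo_cnj (octo_cnj x) = x"
  by (simp add: octo_simps octo_eq_iff prod_eq_iff complex_eq_iff)

lemma octo_cnj_mult: "octo_cnj (x * y) = octo_cnj y * octo_cnj x"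
  by (simp add: octo_simps octo_eq_iff prod_eq_iff complex_eq_iff algebra_simps)

lemma norm_octo_cnj [simp]: "norm (octo_cnj x) = norm x"
  by (simp add: norm_octo_def inner_octo_def octo_simps inner_prod_def inner_complex_def)

lemma norm_octo_one [simp]: "norm (1 :: octo) = 1"
  by (simp add: norm_octo_def inner_octo_def octo_simps inner_prod_def inner_complex_def)

lemma octo_Re_mult_commute: "octo_Re (x * y) = octo_Re (y * x)"
  by (simp add: octo_simps algebra_simps)

text \<open>The associator of three octonions is purely imaginary, so brackets may be moved under
  the real part.\<close>

lemma octo_Re_mult_assoc: "octo_Re (x * (y * z)) = octo_Re ((x * y) * z)"
  by (simp add: octo_simps algebra_simps)

lemma octo_cnj_eq: "octo_cnj x = (2 * octo_Re x) *\<^sub>R 1 - x"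
  by (simp add: octo_simps octo_eq_iff prod_eq_iff complex_eq_iff)

lemma octo_cnj_mult_self: "octo_cnj x * x = (norm x)\<^sup>2 *\<^sub>R 1"
  using octo_mult_cnj[of "octo_cnj x"] by simp

lemma octo_Re_le_norm: "\<bar>octo_Re x\<bar> \<le> norm x"
proof -
  have "octo_Re x = inner x 1"
    by (simp add: inner_octo_def octo_simps inner_prod_def inner_complex_def)
  then show ?thesis
    using Cauchy_Schwarz_ineq2[of x 1] by simp
qed

text \<open>The trace form is nondegenerate: taking \<open>p\<close> to be the conjugate of
  \<open>x - y\<close> yields the squared norm of the difference.\<close>

lemma octo_eqI:
  assumes "\<And>p. octo_Re (p * x) = octo_Re (p * y)"
  shows "x = y"
proof -
  have "octo_Re (octo_cnj (x - y) * (x - y)) = 0"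
    using assms[of "octo_cnj (x - y)"]
    by (simp add: bilinear_rsub[OF bilinear_octo_mult] octo_Re_simps)
  then show ?thesis
    by (simp add: octo_cnj_mult_self octo_Re_simps)
qed

section \<open>Scalar action, adjoints and Cauchy-Schwarz\<close>

lemma osmult_diff_left: "(p - q) *\<^sub>O x = p *\<^sub>O x - q *\<^sub>O (x::'a::octo_module)"
  using osmult_add_left[of "p - q" q x] by simp

text \<open>The conjugate of \<open>p\<close> is a real combination of \<open>1\<close> and
  \<open>p\<close>, so alternativity does the work of associativity.\<close>

lemma osmult_cnj_left: "octo_cnj p *\<^sub>O p *\<^sub>O x = (norm p)\<^sup>2 *\<^sub>R (x::'a::octo_module)"
proof -
  have "octo_cnj p *\<^sub>O p *\<^sub>O x = ((2 * octo_Re p) *\<^sub>R p - p * p) *\<^sub>O x"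
    by (simp add: octo_cnj_eq osmult_diff_left osmult_scaleR_left osmult_one osmult_alternative)
  also have "(2 * octo_Re p) *\<^sub>R p - p * p = octo_cnj p * p"
    by (simp add: octo_cnj_eq bilinear_lsub[OF bilinear_octo_mult]
        bilinear_lmul[OF bilinear_octo_mult] octo_mult_one)
  finally show ?thesis
    by (simp add: octo_cnj_mult_self osmult_scaleR_left osmult_one)
qed

lemma octo_Re_oinner_osmult:
  "octo_Re (oinner (p *\<^sub>O x) (y::'a::octo_pre_hilbert)) = octo_Re (p * oinner x y)"
  using para_linear_oinner[of y] by (simp add: para_linear_def octo_Re_simps)

lemma octo_Re_oinner_commute:
  "octo_Re (oinner x y) = octo_Re (oinner y (x::'a::octo_pre_hilbert))"
  by (subst oinner_cnj) simp

text \<open>Conjugating under the real part swaps the arguments of \<open>oinner\<close> and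
  conjugates \<open>p\<close>, so para-linearity can be used in either argument.\<close>

lemma octo_Re_oinner_adjoint:
  "octo_Re (oinner (p *\<^sub>O x) y) = octo_Re (oinner x (octo_cnj p *\<^sub>O (y::'a::octo_pre_hilbert)))"
proof -
  have "octo_Re (oinner (p *\<^sub>O x) y) = octo_Re (octo_cnj (p * oinner x y))"
    by (simp add: octo_Re_oinner_osmult)
  also have "\<dots> = octo_Re (octo_cnj p * oinner y x)"
    by (simp add: octo_cnj_mult octo_Re_mult_commute oinner_cnj[of y x])
  also have "\<dots> = octo_Re (oinner x (octo_cnj p *\<^sub>O y))"
    by (simp add: octo_Re_oinner_osmult octo_Re_oinner_commute[of x])
  finally show ?thesis .
qed

lemma bilinear_octo_Re_oinner:
  "bilinear (\<lambda>x y::'a::octo_pre_hilbert. octo_Re (oinner x y))"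
  unfolding bilinear_def
  by (auto intro!: linearI simp: oinner_add_left oinner_add_right oinner_scaleR_left
      oinner_scaleR_right octo_Re_simps)

lemma oinner_self: "oinner x x = (norm x)\<^sup>2 *\<^sub>R (1::octo)" for x :: "'a::octo_hilbert"
proof -
  obtain r where r: "r \<ge> 0" "oinner x x = r *\<^sub>R 1"
    using oinner_self_nonneg by blast
  then have "(norm x)\<^sup>2 = r"
    by (simp add: norm_eq_oinner_norm oinner_norm_def octo_Re_simps)
  then show ?thesis
    using r by simp
qed

lemma norm_osmult: "norm (p *\<^sub>O x) = norm p * norm (x::'a::octo_hilbert)"
proof -
  have "octo_Re (oinner (p *\<^sub>O x) (p *\<^sub>O x)) = octo_Re (oinner x ((norm p)\<^sup>2 *\<^sub>R x))"
    by (simp add: octo_Re_oinner_adjoint osmult_cnj_left)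
  then have "(norm (p *\<^sub>O x))\<^sup>2 = (norm p * norm x)\<^sup>2"
    by (simp add: oinner_self oinner_scaleR_right octo_Re_simps power_mult_distrib)
  then show ?thesis
    by (simp add: power2_eq_iff_nonneg)
qed

lemma bounded_linear_osmult: "bounded_linear (\<lambda>x::'a::octo_hilbert. p *\<^sub>O x)"
  by (rule bounded_linear_intro[where K = "norm p"])
    (simp_all add: osmult_add_right osmult_scaleR_right norm_osmult)

text \<open>Multiplying \<open>x\<close> by the conjugate of \<open>oinner x y\<close> turns the
  real part into the squared norm of that value. The real Cauchy-Schwarz inequality then applies,
  and one factor cancels.\<close>

lemma norm_oinner_le: "norm (oinner x y) \<le> norm x * norm (y::'a::octo_hilbert)"
proof (cases "oinner x y = 0")
  case False
  let ?q = "octo_cnj (oinner x y)"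
  have "(norm (oinner x y))\<^sup>2 = octo_Re (oinner (?q *\<^sub>O x) y)"
    by (simp add: octo_Re_oinner_osmult octo_cnj_mult_self octo_Re_simps)
  also have "\<dots> \<le> norm (?q *\<^sub>O x) * norm y"
    by (simp add: norm_eq_oinner_norm Re_oinner_Cauchy_Schwarz)
  finally have "norm (oinner x y) * norm (oinner x y) \<le> norm (oinner x y) * (norm x * norm y)"
    by (simp add: norm_osmult power2_eq_square mult.assoc)
  then show ?thesis
    using False by simp
qed simp

lemma bounded_bilinear_oinner: "bounded_bilinear (oinner :: 'a::octo_hilbert \<Rightarrow> 'a \<Rightarrow> octo)"
  by (rule bounded_bilinear.intro)
    (auto simp: oinner_add_left oinner_add_right oinner_scaleR_left oinner_scaleR_right
      intro!: exI[of _ 1] norm_oinner_le)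

section \<open>Functionals represented by vectors\<close>

lift_definition oinner_functional :: "'a::octo_hilbert \<Rightarrow> 'a \<Rightarrow>\<^sub>L octo" is "\<lambda>m x. oinner x m"
  by (rule bounded_bilinear.bounded_linear_left[OF bounded_bilinear_oinner])

text \<open>Cauchy-Schwarz gives one bound, evaluation at \<open>m\<close> itself the other.\<close>

lemma norm_oinner_functional: "norm (oinner_functional m) = norm m"
proof (rule antisym)
  show "norm (oinner_functional m) \<le> norm m"
    by (rule norm_blinfun_bound)
      (use norm_oinner_le in \<open>simp_all add: oinner_functional.rep_eq mult.commute\<close>)
  show "norm m \<le> norm (oinner_functional m)"
    using norm_blinfun[of "oinner_functional m" m]
    by (cases "m = 0") (simp_all add: oinner_functional.rep_eq oinner_self power2_eq_square)
qed

lemma eq_if_octo_Re_oinner_eq: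
  assumes "\<And>x::'a::octo_pre_hilbert. octo_Re (oinner x m) = octo_Re (oinner x n)"
  shows "m = n"
proof -
  have "octo_Re (oinner (m - n) (m - n)) = 0"
    using assms by (simp add: bilinear_rsub[OF bilinear_octo_Re_oinner])
  then have "oinner_norm (m - n) = 0"
    by (simp add: oinner_norm_def)
  then show ?thesis
    by (simp add: oinner_norm_eq_0)
qed

text \<open>Multiplied by \<open>q\<close> under the real part, the two sides of the homogeneity
  equation become real inner products of \<open>x\<close> with the two bracketings of conjugated
  scalars acting on \<open>m\<close>. Nondegeneracy of both forms converts one condition into the
  other.\<close>

lemma octo_linear_oinner_iff:
  "octo_linear (\<lambda>x. oinner x m) \<longleftrightarrow> m \<in> nucleus" for m :: "'a::octo_pre_hilbert"
proof -
  have left: "octo_Re (q * oinner (p *\<^sub>O x) m)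
      = octo_Re (oinner x (octo_cnj p *\<^sub>O octo_cnj q *\<^sub>O m))" for p q x
    by (simp add: octo_Re_oinner_adjoint flip: octo_Re_oinner_osmult)
  have right: "octo_Re (q * (p * oinner x m))
      = octo_Re (oinner x ((octo_cnj p * octo_cnj q) *\<^sub>O m))" for p q x
    by (simp add: octo_Re_mult_assoc octo_Re_oinner_adjoint octo_cnj_mult
        flip: octo_Re_oinner_osmult)
  show ?thesis
  proof
    assume lin: "octo_linear (\<lambda>x. oinner x m)"
    have "(p * q) *\<^sub>O m = p *\<^sub>O q *\<^sub>O m" for p q
    proof (rule eq_if_octo_Re_oinner_eq)
      fix x
      show "octo_Re (oinner x ((p * q) *\<^sub>O m)) = octo_Re (oinner x (p *\<^sub>O q *\<^sub>O m))"
        \<comment> \<open>Starting from conjugates makes the conjugations in \<open>left\<close> and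
          \<open>right\<close> cancel.\<close>
        using left[of "octo_cnj q" "octo_cnj p" x] right[of "octo_cnj q" "octo_cnj p" x] lin
        by (simp add: octo_linear_def)
    qed
    then show "m \<in> nucleus"
      by (simp add: nucleus_def)
  next
    assume "m \<in> nucleus"
    then have "oinner (p *\<^sub>O x) m = p * oinner x m" for p x
      by (intro octo_eqI) (simp add: left right nucleus_def)
    then show "octo_linear (\<lambda>x. oinner x m)"
      by (auto simp: octo_linear_def oinner_add_left oinner_scaleR_left intro!: linearI)
  qed
qed

lemma octo_linear_represented:
  fixes f :: "'a::octo_hilbert \<Rightarrow>\<^sub>L octo"
  assumes "octo_linear f"
  shows "\<exists>m. f = oinner_functional m"
proof -
  have "bounded_linear octo_Re"
    by (rule bounded_linear_intro[where K = 1]) (simp_all add: octo_Re_simps octo_Re_le_norm)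
  then have "bounded_linear (\<lambda>x. octo_Re (f x))"
    by (rule bounded_linear_compose) (rule blinfun.bounded_linear_right)
  then have "\<exists>m. \<forall>x. octo_Re (f x) = octo_Re (oinner x m)"
    by (intro riesz_representation bilinear_octo_Re_oinner octo_Re_oinner_commute)
      (simp add: oinner_self octo_Re_simps)
  then obtain m where m: "\<And>x. octo_Re (f x) = octo_Re (oinner x m)"
    by blast
  \<comment> \<open>Riesz matches only real parts. At \<open>p *\<^sub>O x\<close>, linearity of
    \<open>f\<close> and para-linearity of \<open>oinner\<close> pull \<open>p\<close> out, so all
    components agree.\<close>
  have "f x = oinner x m" for x
    using assms m[of "_ *\<^sub>O x"]
    by (intro octo_eqI) (simp add: octo_linear_def octo_Re_oinner_osmult)
  then show ?thesis
    by (intro exI[of _ m] blinfun_eqI) (simp add: oinner_functional.rep_eq)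
qed

section \<open>Completeness of the nucleus and of the dual\<close>

lemma banach_subspace_closedI:
  fixes S :: "'a::banach set"
  assumes "subspace S" "closed S"
  shows "banach_subspace S"
  using assms by (simp add: banach_subspace_def complete_eq_closed)

lemma banach_subspace_nucleus: "banach_subspace (nucleus :: 'a::octo_hilbert set)"
proof (rule banach_subspace_closedI)
  show "subspace (nucleus :: 'a set)"
    by (rule subspaceI)
      (simp_all add: nucleus_def osmult_add_right osmult_scaleR_right
        linear_0[OF bounded_linear.linear[OF bounded_linear_osmult]])
  \<comment> \<open>The nucleus is an intersection of equalizers of continuous maps.\<close>
  have "closed {m::'a. (p * q) *\<^sub>O m = p *\<^sub>O q *\<^sub>O m}" for p q
    by (intro closed_Collect_eq bounded_linear.continuous_on[OF bounded_linear_osmult]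
        continuous_on_id)
  then show "closed (nucleus :: 'a set)"
    unfolding nucleus_def by (intro closed_Collect_all)
qed

lemma banach_subspace_octo_dual: "banach_subspace (octo_dual :: ('a::octo_hilbert \<Rightarrow>\<^sub>L octo) set)"
proof (rule banach_subspace_closedI)
  \<comment> \<open>Real linearity is built into the type, leaving only equations between
    evaluations, each a closed condition on \<open>f\<close>.\<close>
  have dual: "octo_dual = {f :: 'a \<Rightarrow>\<^sub>L octo. \<forall>p x. f (p *\<^sub>O x) = p * f x}"
    by (simp add: octo_dual_def octo_linear_def
        bounded_linear.linear[OF blinfun.bounded_linear_right])
  show "subspace (octo_dual :: ('a \<Rightarrow>\<^sub>L octo) set)"
    unfolding dual
    by (rule subspaceI)
      (simp_all add: blinfun.add_left blinfun.scaleR_left bilinear_rzero[OF bilinear_octo_mult]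
        bilinear_radd[OF bilinear_octo_mult] bilinear_rmul[OF bilinear_octo_mult])
  have "closed {f :: 'a \<Rightarrow>\<^sub>L octo. f (p *\<^sub>O x) = p * f x}" for p x
  proof (rule closed_Collect_eq)
    have "bounded_linear ((*) p)"
      using bilinear_octo_mult by (simp add: bilinear_def linear_conv_bounded_linear)
    then show "continuous_on UNIV (\<lambda>f :: 'a \<Rightarrow>\<^sub>L octo. p * f x)"
      by (rule bounded_linear.continuous_on) (intro continuous_intros)
  qed (intro continuous_intros)
  then show "closed (octo_dual :: ('a \<Rightarrow>\<^sub>L octo) set)"
    unfolding dual by (intro closed_Collect_all)
qed

section \<open>The isometric isomorphism\<close>

text \<open>Riesz representation naturally gives a map from the nucleus to the dual; this reverses
  it. Closure of \<open>S\<close> under sums and multiples lets \<open>inv_into\<close> undo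
  \<open>\<phi>\<close> there.\<close>

lemma isometric_isomorphism_on_inv_into:
  assumes iso: "isometric_isomorphism_on S T \<phi>" and "subspace S"
  shows "isometric_isomorphism_on T S (inv_into S \<phi>)"
proof -
  have bij: "bij_betw \<phi> S T"
    using iso by (simp add: isometric_isomorphism_on_def)
  then have T: "T = \<phi> ` S" and inj: "inj_on \<phi> S"
    by (simp_all add: bij_betw_def)
  have "inv_into S \<phi> (\<phi> x + \<phi> y) = x + y" "inv_into S \<phi> (r *\<^sub>R \<phi> x) = r *\<^sub>R x"
    if "x \<in> S" "y \<in> S" for x y r
    using iso that subspace_add[OF \<open>subspace S\<close> that] subspace_scale[OF \<open>subspace S\<close> that(1), of r]
    by (metis inv_into_f_f[OF inj] isometric_isomorphism_on_def)+
  then show ?thesis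
    using iso bij_betw_inv_into[OF bij]
    by (simp add: isometric_isomorphism_on_def T inv_into_f_f[OF inj])
qed

lemma isometric_isomorphism_oinner_functional:
  "isometric_isomorphism_on nucleus octo_dual
    (oinner_functional :: 'a::octo_hilbert \<Rightarrow> 'a \<Rightarrow>\<^sub>L octo)"
proof -
  have add: "oinner_functional (x + y) = oinner_functional x + oinner_functional y"
    and scale: "oinner_functional (r *\<^sub>R x) = r *\<^sub>R oinner_functional x" for x y :: 'a and r
    by (auto intro!: blinfun_eqI simp: oinner_functional.rep_eq blinfun.add_left
        blinfun.scaleR_left oinner_add_right oinner_scaleR_right)
  have "linear (oinner_functional :: 'a \<Rightarrow> 'a \<Rightarrow>\<^sub>L octo)"
    by (rule linearI) (rule add scale)+
  then have inj: "inj (oinner_functional :: 'a \<Rightarrow> 'a \<Rightarrow>\<^sub>L octo)"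
    by (simp add: linear_injective_0) (metis norm_oinner_functional norm_eq_zero)
  have mem: "oinner_functional m \<in> octo_dual \<longleftrightarrow> m \<in> nucleus" for m :: 'a
    by (simp add: octo_dual_def oinner_functional.rep_eq octo_linear_oinner_iff)
  \<comment> \<open>Surjectivity: the representing vector is automatically in the nucleus by
    \<open>mem\<close>.\<close>
  have "f \<in> oinner_functional ` nucleus" if f: "f \<in> octo_dual" for f :: "'a \<Rightarrow>\<^sub>L octo"
  proof -
    obtain m where "f = oinner_functional m"
      using octo_linear_represented f by (auto simp: octo_dual_def)
    then show ?thesis
      using mem f by blast
  qed
  then have "bij_betw oinner_functional (nucleus :: 'a set) octo_dual"
    using mem inj by (auto simp: bij_betw_def intro: inj_on_subset)
  then show ?thesis
    by (simp add: isometric_isomorphism_on_def add scale norm_oinner_functional)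
qed

theorem theorem5p8:
  shows "banach_subspace (octo_dual :: ('h::octo_hilbert \<Rightarrow>\<^sub>L octo) set)
    \<and> banach_subspace (nucleus :: 'h set)
    \<and> (\<exists>\<phi>. isometric_isomorphism_on (octo_dual :: ('h \<Rightarrow>\<^sub>L octo) set) (nucleus :: 'h set) \<phi>)"
  using isometric_isomorphism_on_inv_into[OF isometric_isomorphism_oinner_functional]
    banach_subspace_octo_dual banach_subspace_nucleus
  by (auto simp: banach_subspace_def)

end
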